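(* Let $G$ be a bipartite graph with vertex classes $V=\{v_1,\ldots,v_n\}$ and $W=\{w_1,\ldots,w_n\}$. Denote $d_i=\deg(v_i)$ and $D_i=\deg(w_i)$ for $1\le i\le n$, and assume $1\le d_1\le d_2\le\cdots\le d_n$ and $1\le D_1\le D_2\le\cdots\le D_n$. Let $h$ be an integer with $1\le h<n$. Define $$M_h:=\sum_{j=1}^h D_{n+1-j}-h,$$ let $\Gamma$ be the multiset $$\Gamma:=\bigl\{\Delta_t(d_i):\ 1\le i\le n-h,\ 0\le t\le \min\{h-1,d_i-2\}\bigr\},$$ write its elements in non-increasing order as $\lambda_1\ge\lambda_2\ge\cdots\ge\lambda_{|\Gamma|}$, and set $q:=\min\{M_h,|\Gamma|\}$. Then $$|\mathcal M_{\mathrm{perf}}(G)|\le h!\ \prod_{i=1}^{n-h}(d_i!)^{\frac{1}{d_i}}\ \prod_{r=1}^{q}2^{\lambda_r}.$$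
   Context: A perfect matching of a graph $G=(V(G),E(G))$ is a subset $\sigma\subseteq E(G)$ such that every vertex of $G$ is incident with exactly one edge of $\sigma$; $\mathcal M_{\mathrm{perf}}(G)$ denotes the set of all perfect matchings of $G$. All logarithms are base $2$. For integers $d\ge 1$ and $0\le t\le d-1$, let $H_t(d):=\frac{1}{d-t}\log\frac{d!}{t!}$, and for $0\le t\le d-2$ let $$\Delta_t(d):=H_{t+1}(d)-H_t(d)=\frac{1}{(d-t)(d-t-1)}\log\frac{d!}{t!\,(t+1)^{d-t}}.$$ $\Gamma$ is a multiset indexed by the pairs $(i,t)$ (values are counted with multiplicity, so $|\Gamma|$ is the number of such pairs; indices $i$ with $d_i=1$ contribute nothing). An empty product is interpreted as $1$. *)

theory Defs
  imports "HOL-Analysis.Analysis" "HOL-Library.Multiset" "HOL-Library.Ramsey"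
begin

text \<open>
  A graph is given by its vertex set and its edge set; it is finite and simple, so an edge is a
  two-element set of vertices.
\<close>

definition simple_graph :: "'a set \<Rightarrow> 'a set set \<Rightarrow> bool" where
  "simple_graph V E \<longleftrightarrow> finite V \<and> E \<subseteq> [V]\<^bsup>2\<^esup>"

definition bipartite_graph :: "'a set \<Rightarrow> 'a set \<Rightarrow> 'a set set \<Rightarrow> bool" where
  "bipartite_graph V W E \<longleftrightarrow>
     simple_graph (V \<union> W) E \<and> V \<inter> W = {} \<and> (\<forall>e\<in>E. \<exists>x\<in>V. \<exists>y\<in>W. e = {x, y})"

definition vertex_degree :: "'a set set \<Rightarrow> 'a \<Rightarrow> nat" where
  "vertex_degree E x = card {e \<in> E. x \<in> e}"

definition perfect_matchings :: "'a set \<Rightarrow> 'a set set \<Rightarrow> 'a set set set" where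
  "perfect_matchings V E = {\<sigma>. \<sigma> \<subseteq> E \<and> (\<forall>x\<in>V. \<exists>!e. e \<in> \<sigma> \<and> x \<in> e)}"

text \<open>The following two are meant for \<open>t < d\<close> and \<open>t + 2 \<le> d\<close>, respectively.\<close>

definition H_val :: "nat \<Rightarrow> nat \<Rightarrow> real" where
  "H_val t d = 1 / (real d - real t) * log 2 (fact d / fact t)"

definition Delta :: "nat \<Rightarrow> nat \<Rightarrow> real" where
  "Delta t d = H_val (t + 1) d - H_val t d"

lemma Delta_closed_form:
  assumes "t + 2 \<le> d"
  shows "Delta t d = 1 / ((real d - real t) * (real d - real t - 1)) *
           log 2 (fact d / (fact t * (real t + 1) ^ (d - t)))"
proof -
  define A where "A = log 2 (fact d :: real)"
  define B where "B = log 2 (fact t :: real)"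
  define C where "C = log 2 (real t + 1)"
  define x where "x = real d - real t"
  have x: "x \<noteq> 0" "x - 1 \<noteq> 0" using assms by (auto simp: x_def)
  have f: "(fact (t + 1) :: real) = (real t + 1) * fact t" by simp
  have 1: "log 2 (fact d / fact t) = A - B"
    by (simp add: A_def B_def log_divide)
  have 2: "log 2 (fact d / fact (t + 1)) = A - (C + B)"
    unfolding f A_def B_def C_def
    by (subst log_divide) (simp_all add: log_mult del: fact_Suc)
  have 3: "log 2 (fact d / (fact t * (real t + 1) ^ (d - t))) = A - (B + x * C)"
    unfolding A_def B_def C_def x_def using assms
    by (subst log_divide) (simp_all add: log_mult log_nat_power of_nat_diff)
  have 4: "real d - real (t + 1) = x - 1" by (simp add: x_def)
  have "Delta t d = 1 / (x - 1) * (A - (C + B)) - 1 / x * (A - B)"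
    unfolding Delta_def H_val_def 1 2 4 by (simp add: x_def)
  also have "\<dots> = 1 / (x * (x - 1)) * (A - (B + x * C))"
    using x by (simp add: divide_simps) (simp add: algebra_simps)
  finally show ?thesis unfolding 3 by (simp add: x_def)
qed

text \<open>
  The bound on \<open>t\<close> is taken in the integers: for \<open>d i = 1\<close> the difference is negative, so such an
  index contributes nothing, whereas truncated subtraction would admit \<open>t = 0\<close>.
\<close>

definition Gamma_mset :: "nat \<Rightarrow> nat \<Rightarrow> (nat \<Rightarrow> nat) \<Rightarrow> real multiset" where
  "Gamma_mset n h d =
     image_mset (\<lambda>(i, t). Delta t (d i))
       (mset_set {(i, t). 1 \<le> i \<and> i \<le> n - h \<and> int t \<le> min (int h - 1) (int (d i) - 2)})"

text \<open>
  The \<open>r\<close>-th largest element of a multiset, counted with multiplicity and starting from \<open>r = 1\<close>;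
  meaningful for \<open>1 \<le> r \<le> size X\<close>.
\<close>

definition nth_largest :: "real multiset \<Rightarrow> nat \<Rightarrow> real" where
  "nth_largest X r = rev (sorted_list_of_multiset X) ! (r - 1)"

text \<open>The subtraction does not truncate when all \<open>D i\<close> with \<open>1 \<le> i \<le> n\<close> are positive and \<open>h \<le> n\<close>.\<close>

definition M_val :: "nat \<Rightarrow> nat \<Rightarrow> (nat \<Rightarrow> nat) \<Rightarrow> nat" where
  "M_val n h D = (\<Sum>j=1..h. D (n + 1 - j)) - h"

end

theory Submission
  imports Defs
begin

text \<open>
  Why the bound holds. Read a perfect matching as a bijection \<open>\<sigma> : V \<rightarrow> W\<close> and let \<open>A\<close> consist of
  the first \<open>n - h\<close> vertices of \<open>V\<close>. Reveal the partners of the vertices of \<open>A\<close> one after the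
  other, in an order given by a permutation \<open>\<pi>\<close>. When it is the turn of \<open>x\<close>, let \<open>c(\<sigma>, \<pi>, x)\<close> be
  the number of neighbours of \<open>x\<close> that are not yet taken. A greedy random matcher that picks one
  of these uniformly at every step reproduces \<open>\<sigma>\<close> on \<open>A\<close> with probability
  \<open>\<Prod>\<^sub>x 1 / c(\<sigma>, \<pi>, x)\<close>, and at most \<open>h!\<close> matchings agree on \<open>A\<close>; so for each \<open>\<pi>\<close> the
  sum over \<open>\<sigma>\<close> of these products is at most \<open>h!\<close> (\<open>sum_greedy_weights_le\<close>).

  By concavity of the logarithm, the number of matchings is then at most \<open>h!\<close> times \<open>2\<close> to the
  average of \<open>\<Sum>\<^sub>x log c(\<sigma>, \<pi>, x)\<close> over \<open>\<sigma>\<close> and \<open>\<pi>\<close>. Fix \<open>\<sigma>\<close> and a vertex \<open>x\<close> of degree \<open>d\<close>,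
  and let \<open>t\<close> be the number of neighbours of \<open>x\<close> whose partners lie outside \<open>A\<close>. These are
  available throughout, while among the other \<open>d - t\<close> neighbours a random order makes the number
  of available ones uniform on \<open>1, \<dots>, d - t\<close>. Hence the average of \<open>log c(\<sigma>, \<pi>, x)\<close> over \<open>\<pi>\<close> is
  exactly \<open>H\<^sub>t(d)\<close>; this is where these numbers come from
  (\<open>sum_over_permutations_rank\<close>, \<open>card_le_of_H_val_bound\<close>).

  It remains to bound \<open>\<Sum>\<^sub>x H\<^sub>t(d)\<close> for a single \<open>\<sigma>\<close>. As \<open>H\<^sub>t(d)\<close> is \<open>H\<^sub>0(d)\<close> plus the sum of the
  \<open>\<Delta>\<^sub>s(d)\<close> over \<open>s < t\<close>, the excess over the Bregman--Minc exponent \<open>\<Sum>\<^sub>x H\<^sub>0(d)\<close> is a sum of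
  entries of \<open>\<Gamma>\<close> with different indices, one for each unit of \<open>\<Sum>\<^sub>x t\<close>. That number counts the edges from \<open>A\<close>
  to the \<open>h\<close> partners of the vertices outside \<open>A\<close>. Each of these partners spends one edge on its
  own match, so there are at most \<open>M\<^sub>h\<close> such edges (\<open>sum_card_unused_neighbours_le\<close>). As all
  \<open>\<Delta>\<^sub>s(d)\<close> are nonnegative, the excess is at most the sum of the \<open>q\<close> largest entries.
\<close>

section \<open>Greedy exposure of an injection in a fixed order\<close>

text \<open>
  The product is the probability that the greedy random process, which visits the vertices of rank
  below \<open>k\<close> in order of rank, follows \<open>\<sigma>\<close>. Functions that agree on the visited vertices share
  this probability, and over the classes of this agreement the probabilities add up to at most
  \<open>1\<close>; so the total cannot exceed the largest weight of a class. The weight \<open>f\<close> is what makes the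
  induction work: the factor of the last visited vertex is absorbed into \<open>f\<close>.
\<close>

lemma sum_greedy_weights_le:
  fixes r :: "'a \<Rightarrow> nat" and N :: "'a \<Rightarrow> 'b set" and f :: "('a \<Rightarrow> 'b) \<Rightarrow> real"
  assumes fin: "finite S" "finite A" "\<And>x. x \<in> A \<Longrightarrow> finite (N x)"
    and r: "inj_on r A"
    and S: "\<And>\<sigma>. \<sigma> \<in> S \<Longrightarrow> inj_on \<sigma> A" "\<And>\<sigma> x. \<sigma> \<in> S \<Longrightarrow> x \<in> A \<Longrightarrow> \<sigma> x \<in> N x"
    and B: "0 \<le> B"
    and f: "\<And>\<tau>. \<tau> \<in> S \<Longrightarrow> (\<Sum>\<sigma> | \<sigma> \<in> S \<and> (\<forall>x\<in>A. r x < k \<longrightarrow> \<sigma> x = \<tau> x). f \<sigma>) \<le> B"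
  shows "(\<Sum>\<sigma>\<in>S. f \<sigma> * (\<Prod>x | x \<in> A \<and> r x < k. 1 / real (card (N x - \<sigma> ` {y\<in>A. r y < r x})))) \<le> B"
  using f
proof (induction k arbitrary: f)
  case 0
  show ?case
  proof (cases "S = {}")
    case True
    then show ?thesis using B by simp
  next
    case False
    then obtain \<tau> where "\<tau> \<in> S" by blast
    from 0[OF this] show ?thesis by simp
  qed
next
  case (Suc k)
  show ?case
  proof (cases "\<exists>x\<in>A. r x = k")
    case False
    then have eq: "r x < Suc k \<longleftrightarrow> r x < k" if "x \<in> A" for x
      using that by (auto simp: less_Suc_eq)
    have 1: "{x. x \<in> A \<and> r x < Suc k} = {x. x \<in> A \<and> r x < k}" using eq by blast
    have "(\<Sum>\<sigma> | \<sigma> \<in> S \<and> (\<forall>x\<in>A. r x < k \<longrightarrow> \<sigma> x = \<tau> x). f \<sigma>) \<le> B" if "\<tau> \<in> S" for \<tau>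
      using Suc.prems[OF that] eq by (simp cong: ball_cong)
    from Suc.IH[OF this] show ?thesis unfolding 1 .
  next
    case True
    then obtain z where z: "z \<in> A" "r z = k" by blast
    let ?U = "\<lambda>\<sigma>. \<sigma> ` {y\<in>A. r y < k}"
    define g where "g \<sigma> = f \<sigma> / real (card (N z - ?U \<sigma>))" for \<sigma>
    have ins: "{x. x \<in> A \<and> r x < Suc k} = insert z {x. x \<in> A \<and> r x < k}"
      using z r by (auto simp: less_Suc_eq inj_on_def)
    have step: "f \<sigma> * (\<Prod>x | x \<in> A \<and> r x < Suc k. 1 / real (card (N x - \<sigma> ` {y\<in>A. r y < r x})))
        = g \<sigma> * (\<Prod>x | x \<in> A \<and> r x < k. 1 / real (card (N x - \<sigma> ` {y\<in>A. r y < r x})))" for \<sigma>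
      unfolding ins using z fin by (subst prod.insert) (auto simp: g_def)
    \<comment> \<open>A class for \<open>k\<close> splits, by the value at \<open>z\<close>, into at most as many classes for \<open>Suc k\<close> as
      there are values left; this number is the denominator in \<open>g\<close>.\<close>
    have "(\<Sum>\<sigma> | \<sigma> \<in> S \<and> (\<forall>x\<in>A. r x < k \<longrightarrow> \<sigma> x = \<tau> x). g \<sigma>) \<le> B" if \<tau>: "\<tau> \<in> S" for \<tau>
    proof -
      define T where "T = {\<sigma>. \<sigma> \<in> S \<and> (\<forall>x\<in>A. r x < k \<longrightarrow> \<sigma> x = \<tau> x)}"
      define R where "R = N z - ?U \<tau>"
      have finT: "finite T" and finR: "finite R" using fin z by (auto simp: T_def R_def)
      have U: "?U \<sigma> = ?U \<tau>" if "\<sigma> \<in> T" for \<sigma>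
        using that by (intro image_cong) (auto simp: T_def)
      have sub: "(\<lambda>\<sigma>. \<sigma> z) ` T \<subseteq> R"
      proof
        fix y assume "y \<in> (\<lambda>\<sigma>. \<sigma> z) ` T"
        then obtain \<sigma> where \<sigma>: "\<sigma> \<in> T" "y = \<sigma> z" by blast
        then have \<sigma>S: "\<sigma> \<in> S" by (simp add: T_def)
        have "\<sigma> z \<notin> ?U \<sigma>" using S(1)[OF \<sigma>S] z by (auto simp: inj_on_def)
        then show "y \<in> R" using S(2)[OF \<sigma>S z(1)] \<sigma> U[OF \<sigma>(1)] by (simp add: R_def)
      qed
      have fibre: "(\<Sum>\<sigma> | \<sigma> \<in> T \<and> \<sigma> z = y. f \<sigma>) \<le> B" for y
      proof (cases "\<exists>\<rho>\<in>T. \<rho> z = y")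
        case False
        then have "{\<sigma>. \<sigma> \<in> T \<and> \<sigma> z = y} = {}" by blast
        then show ?thesis using B by (simp only: sum.empty)
      next
        case True
        then obtain \<rho> where \<rho>: "\<rho> \<in> T" "\<rho> z = y" by blast
        have "{\<sigma>. \<sigma> \<in> T \<and> \<sigma> z = y} = {\<sigma>. \<sigma> \<in> S \<and> (\<forall>x\<in>A. r x < Suc k \<longrightarrow> \<sigma> x = \<rho> x)}"
        proof -
          have "(\<forall>x\<in>A. r x < Suc k \<longrightarrow> \<sigma> x = \<rho> x) \<longleftrightarrow>
            (\<forall>x\<in>insert z {x. x \<in> A \<and> r x < k}. \<sigma> x = \<rho> x)" for \<sigma>
            unfolding ins[symmetric] by blast
          then show ?thesis using \<rho> by (auto simp: T_def)
        qed
        then show ?thesis using Suc.prems[of \<rho>] \<rho> by (simp add: T_def)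
      qed
      have "(\<Sum>\<sigma>\<in>T. g \<sigma>) = (\<Sum>\<sigma>\<in>T. f \<sigma>) / real (card R)"
        unfolding sum_divide_distrib using U by (intro sum.cong) (auto simp: g_def R_def)
      also have "(\<Sum>\<sigma>\<in>T. f \<sigma>) = (\<Sum>y\<in>R. \<Sum>\<sigma> | \<sigma> \<in> T \<and> \<sigma> z = y. f \<sigma>)"
        using sum.group[OF finT finR sub, of f] by simp
      also have "\<dots> / real (card R) \<le> (\<Sum>y\<in>R. B) / real (card R)"
        using fibre by (intro divide_right_mono sum_mono) auto
      also have "\<dots> \<le> B" using B by simp
      finally show ?thesis by (simp add: T_def)
    qed
    from Suc.IH[OF this] show ?thesis unfolding step .
  qed
qed

section \<open>Averaging over all orders\<close>

lemma sum_over_ranks: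
  fixes r :: "'a \<Rightarrow> nat"
  assumes A: "finite A" and r: "inj_on r A"
  shows "(\<Sum>a\<in>A. f (card {u\<in>A. r a \<le> r u})) = (\<Sum>k=1..card A. f k)"
proof -
  let ?c = "\<lambda>a. card {u\<in>A. r a \<le> r u}"
  have less: "?c b < ?c a" if "a \<in> A" "b \<in> A" "r a < r b" for a b
  proof (rule psubset_card_mono)
    have "a \<in> {u\<in>A. r a \<le> r u} - {u\<in>A. r b \<le> r u}" using that by simp
    moreover have "{u\<in>A. r b \<le> r u} \<subseteq> {u\<in>A. r a \<le> r u}" using that by auto
    ultimately show "{u\<in>A. r b \<le> r u} \<subset> {u\<in>A. r a \<le> r u}" by blast
  qed (use A in simp)
  have inj: "inj_on ?c A"
  proof (rule inj_onI)
    fix a b assume "a \<in> A" "b \<in> A" "?c a = ?c b"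
    then have "r a = r b" using less[of a b] less[of b a] by (metis less_irrefl linorder_neqE_nat)
    then show "a = b" using r \<open>a \<in> A\<close> \<open>b \<in> A\<close> by (auto simp: inj_on_def)
  qed
  have sub: "?c ` A \<subseteq> {1..card A}"
  proof
    fix k assume "k \<in> ?c ` A"
    then obtain a where a: "a \<in> A" "k = ?c a" by blast
    then have "{u\<in>A. r a \<le> r u} \<noteq> {}" by blast
    then have "0 < k" using a A by (simp add: card_gt_0_iff)
    moreover have "k \<le> card A" using a A by (auto intro!: card_mono)
    ultimately show "k \<in> {1..card A}" by simp
  qed
  have "?c ` A = {1..card A}"
    using sub by (intro card_subset_eq) (auto simp: card_image[OF inj])
  then show ?thesis using sum.reindex[OF inj, of f] by simp
qed

text \<open>
  In a random order the rank of \<open>a\<close> among the elements of \<open>Q\<close> is uniformly distributed: swapping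
  \<open>a\<close> with another element of \<open>Q\<close> permutes the orders, so all elements of \<open>Q\<close> have the same rank
  distribution, and in any one order their ranks run through \<open>1, \<dots>, card Q\<close>. The ranking \<open>r\<close>
  only turns permutations of \<open>A\<close> into linear orders of \<open>A\<close>.
\<close>

lemma sum_over_permutations_rank:
  fixes r :: "'a \<Rightarrow> nat" and f :: "nat \<Rightarrow> real"
  assumes A: "finite A" and r: "inj_on r A" and Q: "Q \<subseteq> A" "a \<in> Q"
  shows "(\<Sum>\<pi> | \<pi> permutes A. f (card {u\<in>Q. r (\<pi> a) \<le> r (\<pi> u)}))
    = fact (card A) / real (card Q) * (\<Sum>k=1..card Q. f k)"
proof -
  let ?F = "\<lambda>a. \<Sum>\<pi> | \<pi> permutes A. f (card {u\<in>Q. r (\<pi> a) \<le> r (\<pi> u)})"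
  have finQ: "finite Q" using A Q finite_subset by blast
  have sym: "?F b = ?F a" if b: "b \<in> Q" for b
  proof -
    let ?t = "Transposition.transpose a b"
    have t: "?t permutes A" using b Q by (intro permutes_swap_id) auto
    have tQ: "?t ` Q = Q" using b Q by (intro permutes_image permutes_swap_id) auto
    have card_eq: "card {u\<in>Q. r (\<pi> (?t a)) \<le> r (\<pi> (?t u))} = card {u\<in>Q. r (\<pi> b) \<le> r (\<pi> u)}" for \<pi>
    proof -
      have "?t ` {u\<in>Q. r (\<pi> (?t a)) \<le> r (\<pi> (?t u))} = {u\<in>Q. r (\<pi> b) \<le> r (\<pi> u)}"
        using tQ by auto
      moreover have "card (?t ` {u\<in>Q. r (\<pi> (?t a)) \<le> r (\<pi> (?t u))})
          = card {u\<in>Q. r (\<pi> (?t a)) \<le> r (\<pi> (?t u))}"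
        by (rule card_image[OF permutes_inj_on[OF t]])
      ultimately show ?thesis by simp
    qed
    have "?F a = (\<Sum>\<pi> | \<pi> permutes A. f (card {u\<in>Q. r ((\<pi> \<circ> ?t) a) \<le> r ((\<pi> \<circ> ?t) u)}))"
      by (rule sum_permutations_compose_right[OF t])
    also have "\<dots> = ?F b" by (simp only: o_apply card_eq)
    finally show ?thesis by simp
  qed
  have "real (card Q) * ?F a = (\<Sum>b\<in>Q. ?F b)" using sym by simp
  also have "\<dots> = (\<Sum>\<pi> | \<pi> permutes A. \<Sum>b\<in>Q. f (card {u\<in>Q. r (\<pi> b) \<le> r (\<pi> u)}))"
    by (rule sum.swap)
  also have "\<dots> = (\<Sum>\<pi> | \<pi> permutes A. \<Sum>k=1..card Q. f k)"
  proof (rule sum.cong[OF refl])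
    fix \<pi> assume "\<pi> \<in> {\<pi>. \<pi> permutes A}"
    then have \<pi>: "\<pi> permutes A" by simp
    have "inj_on (r \<circ> \<pi>) Q"
      using \<pi> Q r by (metis comp_inj_on inj_on_subset permutes_image permutes_inj_on image_mono)
    from sum_over_ranks[OF finQ this, of f]
    show "(\<Sum>b\<in>Q. f (card {u\<in>Q. r (\<pi> b) \<le> r (\<pi> u)})) = (\<Sum>k=1..card Q. f k)" by simp
  qed
  also have "\<dots> = fact (card A) * (\<Sum>k=1..card Q. f k)"
    using card_permutations[OF refl A] by simp
  finally have "real (card Q) * ?F a = fact (card A) * (\<Sum>k=1..card Q. f k)" .
  moreover have "real (card Q) \<noteq> 0" using Q finQ by auto
  ultimately show ?thesis by (simp add: divide_simps mult.commute)
qed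

text \<open>
  Hence \<open>H_val t d\<close> is the expected logarithm of a number that is uniform on \<open>t + 1, \<dots>, d\<close>.
\<close>

lemma H_val_eq_mean_log:
  assumes "t < d"
  shows "H_val t d = (\<Sum>k=1..d - t. log 2 (real (t + k))) / real (d - t)"
proof -
  have "(\<Sum>k=1..m. log 2 (real (t + k))) = log 2 (fact (t + m) / fact t)" for m
  proof (induction m)
    case (Suc m)
    have "fact (t + Suc m) / fact t = (fact (t + m) / fact t) * real (t + Suc m)" by simp
    moreover have "log 2 (fact (t + m) / fact t * real (t + Suc m))
        = log 2 (fact (t + m) / fact t) + log 2 (real (t + Suc m))"
      by (rule log_mult_pos) auto
    ultimately show ?case using Suc by (simp del: fact_Suc of_nat_add of_nat_Suc add_Suc_right)
  qed simp
  then show ?thesis using assms by (simp add: H_val_def of_nat_diff)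
qed

section \<open>Counting injections by the mean logarithm of the choices\<close>

text \<open>
  This is the entropy argument of Radhakrishnan for the Bregman--Minc theorem, with the entropy
  replaced by the inequality between the arithmetic and the geometric mean of the greedy
  probabilities \<open>P \<sigma> \<pi>\<close> over all pairs \<open>(\<sigma>, \<pi>)\<close>: the arithmetic mean is at most
  \<open>B / card S\<close>, and the logarithm of the geometric mean is at least \<open>- C\<close>. The part of \<open>N x\<close>
  outside \<open>\<sigma> ` A\<close> is never used up, which is why its size appears as the lower index of \<open>H_val\<close>.
\<close>

lemma card_le_of_H_val_bound:
  fixes N :: "'a \<Rightarrow> 'b set"
  assumes fin: "finite S" "finite A" "\<And>x. x \<in> A \<Longrightarrow> finite (N x)"
    and S: "\<And>\<sigma>. \<sigma> \<in> S \<Longrightarrow> inj_on \<sigma> A" "\<And>\<sigma> x. \<sigma> \<in> S \<Longrightarrow> x \<in> A \<Longrightarrow> \<sigma> x \<in> N x"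
    and B: "\<And>\<tau>. \<tau> \<in> S \<Longrightarrow> real (card {\<sigma>\<in>S. \<forall>x\<in>A. \<sigma> x = \<tau> x}) \<le> B" "0 \<le> B"
    and C: "\<And>\<sigma>. \<sigma> \<in> S \<Longrightarrow> (\<Sum>x\<in>A. H_val (card (N x - \<sigma> ` A)) (card (N x))) \<le> C"
  shows "real (card S) \<le> B * 2 powr C"
proof (cases "S = {}")
  case True
  then show ?thesis using B by simp
next
  case False
  then obtain \<tau> where \<tau>: "\<tau> \<in> S" by blast
  obtain r :: "'a \<Rightarrow> nat" where r: "inj_on r A"
    using finite_imp_inj_to_nat_seg[OF fin(2)] by blast
  have "{\<sigma>\<in>S. \<forall>x\<in>A. \<sigma> x = \<tau> x} \<noteq> {}" using \<tau> by blast
  then have "0 < card {\<sigma>\<in>S. \<forall>x\<in>A. \<sigma> x = \<tau> x}" using fin by (simp add: card_gt_0_iff)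
  then have Bpos: "0 < B" using B(1)[OF \<tau>] by linarith
  define c where "c \<sigma> \<pi> x = card (N x - \<sigma> ` {y\<in>A. r (\<pi> y) < r (\<pi> x)})" for \<sigma> :: "'a \<Rightarrow> 'b" and \<pi> x
  define P where "P \<sigma> \<pi> = (\<Prod>x\<in>A. 1 / real (c \<sigma> \<pi> x))" for \<sigma> \<pi>
  define Perm where "Perm = {\<pi>. \<pi> permutes A}"
  define L where "L = real (card S) * fact (card A)"
  have finPerm: "finite Perm" and cardPerm: "card Perm = fact (card A)"
    using fin card_permutations[OF refl fin(2)] finite_permutations by (auto simp: Perm_def)
  have Lpos: "0 < L" using False fin by (simp add: L_def card_gt_0_iff)
  have injr: "inj_on (\<lambda>x. r (\<pi> x)) A" if "\<pi> \<in> Perm" for \<pi>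
    using that comp_inj_on[of \<pi> A r] r
    by (simp add: Perm_def permutes_image permutes_inj_on comp_def)

  have cpos: "0 < c \<sigma> \<pi> x" if "\<sigma> \<in> S" "x \<in> A" for \<sigma> \<pi> x
  proof -
    have "\<sigma> x \<in> N x - \<sigma> ` {y\<in>A. r (\<pi> y) < r (\<pi> x)}"
      using that S by (auto simp: inj_on_def)
    then show ?thesis using fin that unfolding c_def by (auto simp: card_gt_0_iff)
  qed
  have Ppos: "0 < P \<sigma> \<pi>" if "\<sigma> \<in> S" for \<sigma> \<pi>
    unfolding P_def using cpos[OF that] by (intro prod_pos) simp

  have sumP: "(\<Sum>\<sigma>\<in>S. P \<sigma> \<pi>) \<le> B" if \<pi>: "\<pi> \<in> Perm" for \<pi>
  proof -
    obtain k where k: "\<forall>x\<in>A. r (\<pi> x) < k"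
      using finite_nat_set_iff_bounded[of "(\<lambda>x. r (\<pi> x)) ` A"] fin by auto
    then have A: "{x. x \<in> A \<and> r (\<pi> x) < k} = A" by blast
    have "(\<Sum>\<sigma>\<in>S. 1 * (\<Prod>x | x \<in> A \<and> r (\<pi> x) < k.
        1 / real (card (N x - \<sigma> ` {y\<in>A. r (\<pi> y) < r (\<pi> x)})))) \<le> B"
    proof (rule sum_greedy_weights_le)
      fix \<tau> assume "\<tau> \<in> S"
      moreover have "{\<sigma>. \<sigma> \<in> S \<and> (\<forall>x\<in>A. r (\<pi> x) < k \<longrightarrow> \<sigma> x = \<tau> x)} = {\<sigma>\<in>S. \<forall>x\<in>A. \<sigma> x = \<tau> x}"
        using k by blast
      ultimately show "(\<Sum>\<sigma> | \<sigma> \<in> S \<and> (\<forall>x\<in>A. r (\<pi> x) < k \<longrightarrow> \<sigma> x = \<tau> x). 1) \<le> B"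
        using B(1) by simp
    qed (use fin S B injr[OF \<pi>] in blast)+
    then show ?thesis unfolding A by (simp add: P_def c_def)
  qed

  \<comment> \<open>The available choices at \<open>x\<close> are the \<open>t\<close> values outside \<open>\<sigma> ` A\<close> and the values taken on the
    vertices of \<open>Q\<close> that do not precede \<open>x\<close>.\<close>
  have mean: "(\<Sum>\<pi>\<in>Perm. log 2 (real (c \<sigma> \<pi> x)))
      = fact (card A) * H_val (card (N x - \<sigma> ` A)) (card (N x))" if \<sigma>: "\<sigma> \<in> S" and x: "x \<in> A" for \<sigma> x
  proof -
    define Q where "Q = {u\<in>A. \<sigma> u \<in> N x}"
    define t where "t = card (N x - \<sigma> ` A)"
    have Q: "Q \<subseteq> A" "x \<in> Q" using S \<sigma> x by (auto simp: Q_def)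
    have finQ: "finite Q" using Q fin finite_subset by blast
    have inj: "inj_on \<sigma> A" using S \<sigma> by blast
    have split: "c \<sigma> \<pi> x = t + card {u\<in>Q. r (\<pi> x) \<le> r (\<pi> u)}" for \<pi>
    proof -
      have "N x - \<sigma> ` {y\<in>A. r (\<pi> y) < r (\<pi> x)} = (N x - \<sigma> ` A) \<union> \<sigma> ` {u\<in>Q. r (\<pi> x) \<le> r (\<pi> u)}"
        using inj by (force simp: Q_def inj_on_def)
      then have "c \<sigma> \<pi> x = card ((N x - \<sigma> ` A) \<union> \<sigma> ` {u\<in>Q. r (\<pi> x) \<le> r (\<pi> u)})"
        by (simp add: c_def)
      also have "\<dots> = t + card (\<sigma> ` {u\<in>Q. r (\<pi> x) \<le> r (\<pi> u)})"
        unfolding t_def using fin x finQ Q by (intro card_Un_disjoint) auto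
      also have "card (\<sigma> ` {u\<in>Q. r (\<pi> x) \<le> r (\<pi> u)}) = card {u\<in>Q. r (\<pi> x) \<le> r (\<pi> u)}"
        using inj Q by (intro card_image inj_on_subset[OF inj]) auto
      finally show ?thesis .
    qed
    have "N x = (N x - \<sigma> ` A) \<union> \<sigma> ` Q" by (auto simp: Q_def)
    then have "card (N x) = card ((N x - \<sigma> ` A) \<union> \<sigma> ` Q)" by simp
    also have "\<dots> = t + card (\<sigma> ` Q)"
      unfolding t_def using fin x finQ Q by (intro card_Un_disjoint) auto
    also have "card (\<sigma> ` Q) = card Q" using Q by (intro card_image inj_on_subset[OF inj])
    finally have cN: "card (N x) = t + card Q" .
    have "0 < card Q" using Q finQ by (auto simp: card_gt_0_iff)
    then have H: "H_val t (card (N x)) = (\<Sum>k=1..card Q. log 2 (real (t + k))) / real (card Q)"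
      using H_val_eq_mean_log[of t "card (N x)"] cN by simp
    show ?thesis
      unfolding split Perm_def t_def[symmetric] H
      using sum_over_permutations_rank[OF fin(2) r Q, of "\<lambda>k. log 2 (real (t + k))"] by simp
  qed

  have "- (L * C) \<le> (\<Sum>\<sigma>\<in>S. \<Sum>\<pi>\<in>Perm. log 2 (P \<sigma> \<pi>))"
  proof -
    have "(\<Sum>\<pi>\<in>Perm. log 2 (P \<sigma> \<pi>)) \<ge> - (fact (card A) * C)" if \<sigma>: "\<sigma> \<in> S" for \<sigma>
    proof -
      have "log 2 (P \<sigma> \<pi>) = - (\<Sum>x\<in>A. log 2 (real (c \<sigma> \<pi> x)))" for \<pi>
      proof -
        have "ln (P \<sigma> \<pi>) = (\<Sum>x\<in>A. ln (1 / real (c \<sigma> \<pi> x)))"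
          unfolding P_def using fin cpos[OF \<sigma>] by (intro ln_prod) auto
        also have "\<dots> = - (\<Sum>x\<in>A. ln (real (c \<sigma> \<pi> x)))"
          unfolding sum_negf[symmetric] using cpos[OF \<sigma>] by (intro sum.cong) (auto simp: ln_div)
        finally show ?thesis by (simp add: log_def sum_divide_distrib)
      qed
      then have "(\<Sum>\<pi>\<in>Perm. log 2 (P \<sigma> \<pi>)) = - (\<Sum>x\<in>A. \<Sum>\<pi>\<in>Perm. log 2 (real (c \<sigma> \<pi> x)))"
        by (simp add: sum_negf) (rule sum.swap)
      also have "\<dots> = - (fact (card A) * (\<Sum>x\<in>A. H_val (card (N x - \<sigma> ` A)) (card (N x))))"
        using mean[OF \<sigma>] by (simp add: sum_distrib_left)
      finally show ?thesis using C[OF \<sigma>] by simp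
    qed
    then have "(\<Sum>\<sigma>\<in>S. - (fact (card A) * C)) \<le> (\<Sum>\<sigma>\<in>S. \<Sum>\<pi>\<in>Perm. log 2 (P \<sigma> \<pi>))"
      by (intro sum_mono)
    then show ?thesis by (simp add: L_def)
  qed
  also have "\<dots> \<le> L * log 2 (B / card S)"
  proof -
    define b where "b = B / card S"
    have b: "0 < b" using Bpos False fin by (simp add: b_def card_gt_0_iff)
    \<comment> \<open>Tangent to the logarithm at the upper bound \<open>b\<close> of the mean of \<open>P\<close>: the linear terms then
      add up to at most zero.\<close>
    have tangent: "log 2 (P \<sigma> \<pi>) \<le> log 2 b + (P \<sigma> \<pi> / b - 1) / ln 2" if "\<sigma> \<in> S" for \<sigma> \<pi>
    proof -
      have "ln (P \<sigma> \<pi> / b) \<le> P \<sigma> \<pi> / b - 1"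
        using Ppos[OF that] b by (intro ln_le_minus_one) simp
      then have "ln (P \<sigma> \<pi>) \<le> ln b + (P \<sigma> \<pi> / b - 1)"
        using Ppos[OF that, of \<pi>] b by (simp add: ln_div)
      then have "ln (P \<sigma> \<pi>) / ln 2 \<le> (ln b + (P \<sigma> \<pi> / b - 1)) / ln 2"
        by (intro divide_right_mono) auto
      then show ?thesis unfolding log_def add_divide_distrib .
    qed
    have "(\<Sum>\<sigma>\<in>S. \<Sum>\<pi>\<in>Perm. log 2 (P \<sigma> \<pi>))
        \<le> (\<Sum>\<sigma>\<in>S. \<Sum>\<pi>\<in>Perm. log 2 b + (P \<sigma> \<pi> / b - 1) / ln 2)"
      using tangent by (intro sum_mono)
    also have "\<dots> = L * log 2 b + ((\<Sum>\<sigma>\<in>S. \<Sum>\<pi>\<in>Perm. P \<sigma> \<pi>) / b - L) / ln 2"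
      by (simp add: sum.distrib sum_subtractf cardPerm L_def flip: sum_divide_distrib)
    also have "\<dots> \<le> L * log 2 b"
    proof -
      have "(\<Sum>\<sigma>\<in>S. \<Sum>\<pi>\<in>Perm. P \<sigma> \<pi>) = (\<Sum>\<pi>\<in>Perm. \<Sum>\<sigma>\<in>S. P \<sigma> \<pi>)" by (rule sum.swap)
      also have "\<dots> \<le> (\<Sum>\<pi>\<in>Perm. B)" using sumP by (intro sum_mono)
      also have "\<dots> = L * b" using False fin by (simp add: cardPerm L_def b_def)
      finally have "(\<Sum>\<sigma>\<in>S. \<Sum>\<pi>\<in>Perm. P \<sigma> \<pi>) / b \<le> L" using b by (simp add: field_simps)
      then show ?thesis by (simp add: divide_le_0_iff)
    qed
    finally show ?thesis unfolding b_def .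
  qed
  finally have "L * (- C) \<le> L * log 2 (B / card S)" by simp
  then have "- C \<le> log 2 (B / card S)" using Lpos by (simp only: mult_le_cancel_left_pos)
  then have "2 powr (- C) \<le> B / card S"
    using Bpos False fin by (subst (asm) le_log_iff) (auto simp: card_gt_0_iff)
  then show ?thesis using False fin by (simp add: powr_minus field_simps card_gt_0_iff)
qed

section \<open>Sums of the largest elements\<close>

text \<open>
  The head \<open>x\<close> is paired off with an element \<open>y \<le> x\<close> of \<open>Y\<close>, namely \<open>x\<close> itself if possible, so
  that the rest of \<open>Y\<close> embeds into the tail. Nonnegativity pays for \<open>Y\<close> having fewer than \<open>k\<close>
  elements.
\<close>

lemma sum_mset_le_sum_take:
  fixes xs :: "'a :: {linorder, ordered_comm_monoid_add} list"
  assumes "sorted_wrt (\<ge>) xs" and "\<forall>x\<in>set xs. 0 \<le> x" and "Y \<subseteq># mset xs" and "size Y \<le> k"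
  shows "sum_mset Y \<le> sum_list (take k xs)"
  using assms
proof (induction xs arbitrary: k Y)
  case Nil
  then show ?case by simp
next
  case (Cons x xs)
  show ?case
  proof (cases "Y = {#}")
    case True
    then show ?thesis using Cons.prems(2) set_take_subset[of k "x # xs"]
      by (auto intro!: sum_list_nonneg simp del: take_Suc_Cons)
  next
    case False
    then obtain k' where k: "k = Suc k'" using Cons.prems(4) by (cases k) auto
    obtain y where y: "y \<in># Y" "y \<le> x" "Y - {#y#} \<subseteq># mset xs"
    proof (cases "x \<in># Y")
      case True
      with Cons.prems(3) have "Y - {#x#} \<subseteq># mset xs" by (simp add: subset_eq_diff_conv)
      with True that show thesis by blast
    next
      case nx: False
      have sub: "Y \<subseteq># mset xs"
        using Cons.prems(3) nx by (metis mset.simps(2) diff_single_trivial subset_eq_diff_conv add_mset_add_single)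
      obtain y where "y \<in># Y" using False by blast
      moreover have "y \<in> set xs" using sub calculation by (metis mset_subset_eqD set_mset_mset)
      moreover have "Y - {#y#} \<subseteq># mset xs" using sub by (meson diff_subset_eq_self subset_mset.order_trans)
      ultimately show thesis using that Cons.prems(1) by auto
    qed
    have "sum_mset (Y - {#y#}) \<le> sum_list (take k' xs)"
      using Cons.prems y k by (intro Cons.IH) (auto simp: size_Diff_singleton)
    then have "y + sum_mset (Y - {#y#}) \<le> x + sum_list (take k' xs)" using y by (intro add_mono)
    moreover have "sum_mset Y = y + sum_mset (Y - {#y#})"
      using y by (metis insert_DiffM sum_mset.add_mset)
    ultimately show ?thesis by (simp add: k)
  qed
qed

lemma sum_le_sum_nth_largest:
  assumes I: "finite I" "P \<subseteq> I" and f: "\<And>p. p \<in> I \<Longrightarrow> 0 \<le> f p"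
    and X: "X = image_mset f (mset_set I)" and k: "card P \<le> k" "k \<le> size X"
  shows "sum f P \<le> (\<Sum>r=1..k. nth_largest X r)"
proof -
  define xs where "xs = rev (sorted_list_of_multiset X)"
  have mxs: "mset xs = X" by (simp add: xs_def)
  have len: "k \<le> length xs" using k mxs by (metis size_mset)
  have "sum_mset (image_mset f (mset_set P)) \<le> sum_list (take k xs)"
  proof (rule sum_mset_le_sum_take)
    show "sorted_wrt (\<ge>) xs"
      unfolding xs_def using sorted_sorted_list_of_multiset[of X]
      by (simp add: sorted_wrt_rev)
    have "set xs = set_mset X" using mxs by (metis set_mset_mset)
    then show "\<forall>x\<in>set xs. 0 \<le> x" using f I by (auto simp: X)
    show "image_mset f (mset_set P) \<subseteq># mset xs"
      unfolding mxs X using I by (intro image_mset_subseteq_mono subset_imp_msubset_mset_set)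
    show "size (image_mset f (mset_set P)) \<le> k" using k by simp
  qed
  also have "sum_list (take k xs) = (\<Sum>i<k. xs ! i)"
    using len by (subst sum_list_sum_nth) (simp add: min_def atLeast0LessThan)
  also have "\<dots> = (\<Sum>r=1..k. nth_largest X r)"
    unfolding nth_largest_def xs_def[symmetric]
    by (rule sum.reindex_bij_witness[of _ "\<lambda>r. r - 1" Suc]) auto
  finally show ?thesis by (simp add: sum_unfold_sum_mset)
qed

lemma sum_le_sum_last:
  fixes D :: "nat \<Rightarrow> nat"
  assumes D: "mono_on {1..n} D" and J: "J \<subseteq> {1..n}"
  shows "sum D J \<le> (\<Sum>j=1..card J. D (n + 1 - j))"
proof -
  define xs where "xs = map (\<lambda>j. D (n - j)) [0..<n]"
  have le: "card J \<le> n" using J by (metis card_atLeastAtMost card_mono diff_Suc_1 finite_atLeastAtMost)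
  have "mset xs = image_mset D (mset_set {1..n})"
  proof -
    have "{1..n} = (\<lambda>j. n - j) ` {0..<n}"
    proof (intro equalityI subsetI)
      fix i assume "i \<in> {1..n}"
      then have "i = n - (n - i)" "n - i \<in> {0..<n}" by auto
      then show "i \<in> (\<lambda>j. n - j) ` {0..<n}" by blast
    qed auto
    moreover have "inj_on (\<lambda>j. n - j) {0..<n}" by (auto simp: inj_on_def)
    ultimately have "mset_set {1..n} = image_mset (\<lambda>j. n - j) (mset_set {0..<n})"
      by (simp add: image_mset_mset_set)
    then show ?thesis by (simp add: xs_def image_mset.compositionality comp_def)
  qed
  moreover have "sorted_wrt (\<ge>) xs"
    unfolding xs_def sorted_wrt_map
    by (auto simp: sorted_wrt_iff_nth_less intro!: mono_onD[OF D])
  ultimately have "sum_mset (image_mset D (mset_set J)) \<le> sum_list (take (card J) xs)"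
    using J by (intro sum_mset_le_sum_take) (auto intro!: image_mset_subseteq_mono subset_imp_msubset_mset_set)
  also have "\<dots> = (\<Sum>j<card J. D (n - j))"
    using le by (subst sum_list_sum_nth) (simp add: xs_def min_def atLeast0LessThan)
  also have "\<dots> = (\<Sum>j=1..card J. D (n + 1 - j))"
    by (rule sum.reindex_bij_witness[of _ "\<lambda>r. r - 1" Suc]) auto
  finally show ?thesis by (simp add: sum_unfold_sum_mset)
qed

section \<open>The increments of \<open>H_val\<close>\<close>

lemma Delta_nonneg:
  assumes "t + 2 \<le> d"
  shows "0 \<le> Delta t d"
proof -
  have "fact t * (real t + 1) ^ m \<le> fact (t + m)" for m
  proof (induction m)
    case (Suc m)
    have "fact t * (real t + 1) ^ Suc m = (fact t * (real t + 1) ^ m) * (real t + 1)" by simp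
    also have "\<dots> \<le> fact (t + m) * real (t + Suc m)"
      using Suc by (intro mult_mono) auto
    finally show ?case by (simp add: mult.commute)
  qed simp
  from this[of "d - t"] have "1 \<le> fact d / (fact t * (real t + 1) ^ (d - t))"
    using assms by simp
  then show ?thesis unfolding Delta_closed_form[OF assms] using assms by simp
qed

lemma H_val_eq_sum_Delta: "H_val t d = H_val 0 d + (\<Sum>s<t. Delta s d)"
  by (induction t) (auto simp: Delta_def)

section \<open>Perfect matchings as bijections\<close>

lemma bipartite_graph_commute: "bipartite_graph V W E \<Longrightarrow> bipartite_graph W V E"
  unfolding bipartite_graph_def by (metis Int_commute Un_commute insert_commute)

lemma bipartite_vertex_degree:
  assumes G: "bipartite_graph V W E" and x: "x \<in> V"
  shows "vertex_degree E x = card {y\<in>W. {x, y} \<in> E}"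
proof -
  have "{e \<in> E. x \<in> e} = (\<lambda>y. {x, y}) ` {y\<in>W. {x, y} \<in> E}"
    using G x unfolding bipartite_graph_def by auto
  moreover have "inj_on (\<lambda>y. {x, y}) {y\<in>W. {x, y} \<in> E}"
    by (auto simp: inj_on_def doubleton_eq_iff)
  ultimately show ?thesis unfolding vertex_degree_def by (simp add: card_image)
qed

text \<open>
  The maps are made extensional so that a perfect matching determines its map and there are only
  finitely many of them.
\<close>

definition matching_maps :: "'a set \<Rightarrow> 'a set \<Rightarrow> 'a set set \<Rightarrow> ('a \<Rightarrow> 'a) set" where
  "matching_maps V W E = {\<sigma> \<in> V \<rightarrow>\<^sub>E W. bij_betw \<sigma> V W \<and> (\<forall>x\<in>V. {x, \<sigma> x} \<in> E)}"

lemma finite_matching_maps: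
  assumes "finite V" "finite W"
  shows "finite (matching_maps V W E)"
  using assms by (intro finite_subset[of "matching_maps V W E" "V \<rightarrow>\<^sub>E W"] finite_PiE)
    (auto simp: matching_maps_def)

lemma card_perfect_matchings_le:
  assumes G: "bipartite_graph V W E"
  shows "card (perfect_matchings (V \<union> W) E) \<le> card (matching_maps V W E)"
proof (rule surj_card_le)
  have fin: "finite V" "finite W" using G by (auto simp: bipartite_graph_def simple_graph_def)
  then show "finite (matching_maps V W E)" by (rule finite_matching_maps)
  show "perfect_matchings (V \<union> W) E \<subseteq> (\<lambda>\<sigma>. (\<lambda>x. {x, \<sigma> x}) ` V) ` matching_maps V W E"
  proof
    fix M assume M: "M \<in> perfect_matchings (V \<union> W) E"
    have disj: "V \<inter> W = {}" using G by (simp add: bipartite_graph_def)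
    have edge: "\<exists>x\<in>V. \<exists>y\<in>W. e = {x, y}" if "e \<in> M" for e
      using that M G by (auto simp: perfect_matchings_def bipartite_graph_def)
    have ex: "\<exists>e\<in>M. x \<in> e" if "x \<in> V \<union> W" for x
      using that M by (auto simp: perfect_matchings_def)
    have uniq: "e = e'" if "x \<in> V \<union> W" "e \<in> M" "e' \<in> M" "x \<in> e" "x \<in> e'" for x e e'
      using that M unfolding perfect_matchings_def by blast
    have "\<exists>y. y \<in> W \<and> {x, y} \<in> M" if x: "x \<in> V" for x
    proof -
      obtain e where e: "e \<in> M" "x \<in> e" using ex x by blast
      then obtain x' y where "x' \<in> V" "y \<in> W" "e = {x', y}" using edge by blast
      then show ?thesis using e x disj by (metis IntI empty_iff insertE)
    qed
    then obtain f where f: "\<forall>x\<in>V. f x \<in> W \<and> {x, f x} \<in> M" by metis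
    define \<sigma> where "\<sigma> = restrict f V"
    have \<sigma>: "\<sigma> x \<in> W" "{x, \<sigma> x} \<in> M" if "x \<in> V" for x using f that by (auto simp: \<sigma>_def)
    have determined: "y = \<sigma> x" if "{x, y} \<in> M" "x \<in> V" for x y
      using uniq[of x "{x, y}" "{x, \<sigma> x}"] \<sigma> that by (auto simp: doubleton_eq_iff)
    have "inj_on \<sigma> V"
    proof (rule inj_onI)
      fix x x' assume x: "x \<in> V" "x' \<in> V" "\<sigma> x = \<sigma> x'"
      then have "{x, \<sigma> x} = {x', \<sigma> x'}" using \<sigma>[of x] \<sigma>[of x'] by (intro uniq[of "\<sigma> x"]) auto
      then show "x = x'" using x by (auto simp: doubleton_eq_iff)
    qed
    moreover have "\<sigma> ` V = W"
    proof (intro equalityI subsetI)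
      fix y assume y: "y \<in> W"
      then obtain e where e: "e \<in> M" "y \<in> e" using ex by blast
      then obtain x y' where xy: "x \<in> V" "y' \<in> W" "e = {x, y'}" using edge by blast
      then have "y = y'" using e y disj by blast
      then show "y \<in> \<sigma> ` V" using determined xy e by blast
    qed (use \<sigma> in blast)
    ultimately have "\<sigma> \<in> matching_maps V W E"
      using \<sigma> M by (auto simp: matching_maps_def bij_betw_def \<sigma>_def perfect_matchings_def)
    moreover have "M = (\<lambda>x. {x, \<sigma> x}) ` V"
      using edge determined \<sigma> by blast
    ultimately show "M \<in> (\<lambda>\<sigma>. (\<lambda>x. {x, \<sigma> x}) ` V) ` matching_maps V W E" by blast
  qed
qed

lemma card_matching_maps_agreeing_le:
  assumes fin: "finite V" "finite W" and A: "A \<subseteq> V" and \<tau>: "\<tau> \<in> matching_maps V W E"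
  shows "card {\<sigma> \<in> matching_maps V W E. \<forall>x\<in>A. \<sigma> x = \<tau> x} \<le> fact (card (V - A))"
proof -
  let ?R = "W - \<tau> ` A"
  have bij: "bij_betw \<sigma> (V - A) (W - \<sigma> ` A)" if "\<sigma> \<in> matching_maps V W E" for \<sigma>
  proof -
    have "bij_betw \<sigma> V W" using that by (simp add: matching_maps_def)
    then show ?thesis using A by (metis bij_betw_def image_set_diff inj_on_diff inj_on_image_set_diff Diff_subset)
  qed
  have cardR: "card ?R = card (V - A)" using bij_betw_same_card[OF bij[OF \<tau>]] by simp
  have "card {\<sigma> \<in> matching_maps V W E. \<forall>x\<in>A. \<sigma> x = \<tau> x}
      \<le> card {g \<in> (V - A) \<rightarrow>\<^sub>E ?R. inj_on g (V - A)}"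
  proof (rule card_inj_on_le[where f = "\<lambda>\<sigma>. restrict \<sigma> (V - A)"])
    show "inj_on (\<lambda>\<sigma>. restrict \<sigma> (V - A)) {\<sigma> \<in> matching_maps V W E. \<forall>x\<in>A. \<sigma> x = \<tau> x}"
    proof (rule inj_onI)
      fix \<sigma> \<rho>
      assume a: "\<sigma> \<in> {\<sigma> \<in> matching_maps V W E. \<forall>x\<in>A. \<sigma> x = \<tau> x}"
        "\<rho> \<in> {\<sigma> \<in> matching_maps V W E. \<forall>x\<in>A. \<sigma> x = \<tau> x}"
        "restrict \<sigma> (V - A) = restrict \<rho> (V - A)"
      have "\<sigma> x = \<rho> x" if "x \<in> V" for x
        using a(1,2) that fun_cong[OF a(3), of x] by (cases "x \<in> A") auto
      then show "\<sigma> = \<rho>" using a(1,2) by (auto simp: matching_maps_def intro: PiE_ext)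
    qed
    show "(\<lambda>\<sigma>. restrict \<sigma> (V - A)) ` {\<sigma> \<in> matching_maps V W E. \<forall>x\<in>A. \<sigma> x = \<tau> x}
        \<subseteq> {g \<in> (V - A) \<rightarrow>\<^sub>E ?R. inj_on g (V - A)}"
    proof clarify
      fix \<sigma> assume \<sigma>: "\<sigma> \<in> matching_maps V W E" and eq: "\<forall>x\<in>A. \<sigma> x = \<tau> x"
      have "\<sigma> ` A = \<tau> ` A" using eq by (intro image_cong) auto
      then have "bij_betw \<sigma> (V - A) ?R" using bij[OF \<sigma>] by simp
      then show "restrict \<sigma> (V - A) \<in> (V - A) \<rightarrow>\<^sub>E ?R \<and> inj_on (restrict \<sigma> (V - A)) (V - A)"
        by (auto simp: bij_betw_def)
    qed
    show "finite {g \<in> (V - A) \<rightarrow>\<^sub>E ?R. inj_on g (V - A)}"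
      using fin by (intro finite_subset[of "{g \<in> (V - A) \<rightarrow>\<^sub>E ?R. inj_on g (V - A)}" "(V - A) \<rightarrow>\<^sub>E ?R"] finite_PiE) auto
  qed
  also have "\<dots> = fact (card (V - A))"
    using card_inj_on_subset_funcset[of "V - A" ?R "V - A"] fin cardR
    by (simp add: fact_prod_rev)
  finally show ?thesis .
qed

text \<open>
  The sum on the left counts the edges between \<open>A\<close> and the partners of the vertices outside \<open>A\<close>.
  Every such partner has a further edge, the matching edge, whose other end lies outside \<open>A\<close>;
  these edges account for the summand \<open>card (V - A)\<close>.
\<close>

lemma sum_card_unused_neighbours_le:
  assumes G: "bipartite_graph V W E" and A: "A \<subseteq> V" and \<sigma>: "\<sigma> \<in> matching_maps V W E"
  shows "(\<Sum>x\<in>A. card ({y\<in>W. {x, y} \<in> E} - \<sigma> ` A)) + card (V - A)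
    \<le> (\<Sum>y\<in>\<sigma> ` (V - A). vertex_degree E y)"
proof -
  let ?Y = "\<sigma> ` (V - A)"
  have fin: "finite V" "finite W" using G by (auto simp: bipartite_graph_def simple_graph_def)
  have finA: "finite A" using A fin finite_subset by blast
  have bij: "bij_betw \<sigma> V W" and E: "\<And>x. x \<in> V \<Longrightarrow> {x, \<sigma> x} \<in> E"
    using \<sigma> by (auto simp: matching_maps_def)
  have YW: "?Y = W - \<sigma> ` A" using bij A by (metis bij_betw_def inj_on_image_set_diff Diff_subset)
  have cY: "card ?Y = card (V - A)"
    by (intro card_image inj_on_subset[OF bij_betw_imp_inj_on[OF bij]]) simp
  have "{y\<in>W. {x, y} \<in> E} - \<sigma> ` A = {y\<in>?Y. {x, y} \<in> E}" for x unfolding YW by blast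
  then have "(\<Sum>x\<in>A. card ({y\<in>W. {x, y} \<in> E} - \<sigma> ` A)) = (\<Sum>x\<in>A. card {y\<in>?Y. {x, y} \<in> E})" by simp
  also have "\<dots> = (\<Sum>y\<in>?Y. card {x\<in>A. {x, y} \<in> E})"
    using finA fin by (intro sum_multicount_gen) auto
  finally have "(\<Sum>x\<in>A. card ({y\<in>W. {x, y} \<in> E} - \<sigma> ` A)) + card (V - A)
      = (\<Sum>y\<in>?Y. card {x\<in>A. {x, y} \<in> E} + 1)"
    using cY by (simp add: sum_Suc)
  also have "\<dots> \<le> (\<Sum>y\<in>?Y. vertex_degree E y)"
  proof (rule sum_mono)
    fix y assume "y \<in> ?Y"
    then obtain z where z: "z \<in> V - A" "y = \<sigma> z" by blast
    then have yW: "y \<in> W" using YW by blast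
    have "card {x\<in>A. {x, y} \<in> E} < card {x\<in>V. {y, x} \<in> E}"
    proof (rule psubset_card_mono)
      have "z \<in> {x\<in>V. {y, x} \<in> E} - {x\<in>A. {x, y} \<in> E}"
        using z E by (auto simp: insert_commute)
      moreover have "{x\<in>A. {x, y} \<in> E} \<subseteq> {x\<in>V. {y, x} \<in> E}"
        using A by (auto simp: insert_commute)
      ultimately show "{x\<in>A. {x, y} \<in> E} \<subset> {x\<in>V. {y, x} \<in> E}" by blast
    qed (use fin in simp)
    then show "card {x\<in>A. {x, y} \<in> E} + 1 \<le> vertex_degree E y"
      using bipartite_vertex_degree[OF bipartite_graph_commute[OF G] yW] by simp
  qed
  finally show ?thesis .
qed

section \<open>The refined Bregman--Minc bound\<close>

theorem theorem1p3:
  fixes V W :: "'a set" and E :: "'a set set"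
    and v w :: "nat \<Rightarrow> 'a" and d D :: "nat \<Rightarrow> nat" and n h q :: nat
    and \<Gamma> :: "real multiset"
  assumes "bipartite_graph V W E"
    and "bij_betw v {1..n} V" and "bij_betw w {1..n} W"
    and "\<And>i. i \<in> {1..n} \<Longrightarrow> d i = vertex_degree E (v i)"
    and "\<And>i. i \<in> {1..n} \<Longrightarrow> D i = vertex_degree E (w i)"
    and "1 \<le> d 1" and "mono_on {1..n} d"
    and "1 \<le> D 1" and "mono_on {1..n} D"
    and "1 \<le> h" and "h < n"
    and "\<Gamma> = Gamma_mset n h d"
    and "q = min (M_val n h D) (size \<Gamma>)"
  shows "real (card (perfect_matchings (V \<union> W) E)) \<le>
           fact h * (\<Prod>i=1..n - h. fact (d i) powr (1 / real (d i)))
                  * (\<Prod>r=1..q. 2 powr nth_largest \<Gamma> r)"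
proof -
  note G = assms(1)
  define m where "m = n - h"
  define A where "A = v ` {1..m}"
  define N where "N x = {y\<in>W. {x, y} \<in> E}" for x
  define S where "S = matching_maps V W E"
  define I where "I = {(i, t). 1 \<le> i \<and> i \<le> n - h \<and> int t \<le> min (int h - 1) (int (d i) - 2)}"
  define C where "C = (\<Sum>i=1..m. H_val 0 (d i)) + (\<Sum>r=1..q. nth_largest \<Gamma> r)"
  have fin: "finite V" "finite W" using G by (auto simp: bipartite_graph_def simple_graph_def)
  have AV: "A \<subseteq> V" using assms(2) by (auto simp: A_def m_def bij_betw_def)
  have finA: "finite A" by (simp add: A_def)
  have finS: "finite S" using fin by (simp add: S_def finite_matching_maps)
  have bijA: "bij_betw v {1..m} A"
    by (rule bij_betw_subset[OF assms(2)]) (auto simp: A_def m_def)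
  have cardVA: "card (V - A) = h"
  proof -
    have "card (V - A) = card V - card A" using AV finA by (rule card_Diff_subset[rotated])
    also have "card V = n" using bij_betw_same_card[OF assms(2)] by simp
    also have "card A = m" using bij_betw_same_card[OF bijA] by simp
    finally show ?thesis using assms(11) by (simp add: m_def)
  qed
  have cardN: "card (N (v i)) = d i" if "i \<in> {1..m}" for i
  proof -
    have i: "i \<in> {1..n}" using that by (auto simp: m_def)
    then have "v i \<in> V" using assms(2) by (auto simp: bij_betw_def)
    then show ?thesis using bipartite_vertex_degree[OF G] assms(4)[OF i] by (simp add: N_def)
  qed
  have finI: "finite I"
    by (rule finite_subset[of _ "{1..n} \<times> {..<h}"]) (auto simp: I_def)
  have \<Gamma>: "\<Gamma> = image_mset (\<lambda>(i, t). Delta t (d i)) (mset_set I)"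
    unfolding assms(12) Gamma_mset_def I_def ..

  have pointwise: "(\<Sum>x\<in>A. H_val (card (N x - \<sigma> ` A)) (card (N x))) \<le> C" if \<sigma>: "\<sigma> \<in> S" for \<sigma>
  proof -
    define t where "t i = card (N (v i) - \<sigma> ` A)" for i
    \<comment> \<open>\<open>P\<close> indexes the entries of \<open>\<Gamma>\<close> by which the exponent exceeds the Bregman--Minc exponent.\<close>
    define P where "P = Sigma {1..m} (\<lambda>i. {..<t i})"
    have bij: "bij_betw \<sigma> V W" and E: "\<And>x. x \<in> V \<Longrightarrow> {x, \<sigma> x} \<in> E"
      using \<sigma> by (auto simp: S_def matching_maps_def)
    have YW: "\<sigma> ` (V - A) = W - \<sigma> ` A"
      using bij AV by (metis bij_betw_def inj_on_image_set_diff Diff_subset)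
    have cY: "card (\<sigma> ` (V - A)) = h"
      unfolding cardVA[symmetric]
      by (intro card_image inj_on_subset[OF bij_betw_imp_inj_on[OF bij]]) simp
    \<comment> \<open>These two bounds on \<open>t i\<close> are the two terms of the minimum that limits \<open>t\<close> in \<open>\<Gamma>\<close>.\<close>
    have t_less: "t i < d i" and t_le: "t i \<le> h" if i: "i \<in> {1..m}" for i
    proof -
      have vi: "v i \<in> A" using i by (simp add: A_def)
      then have "\<sigma> (v i) \<in> N (v i)" "\<sigma> (v i) \<in> \<sigma> ` A"
        using E AV bij by (auto simp: N_def bij_betw_def)
      then have "N (v i) - \<sigma> ` A \<subset> N (v i)" by blast
      then have "t i < card (N (v i))" unfolding t_def
        using fin by (intro psubset_card_mono) (auto simp: N_def)
      then show "t i < d i" using cardN[OF i] by simp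
      have "N (v i) - \<sigma> ` A \<subseteq> \<sigma> ` (V - A)" unfolding YW by (auto simp: N_def)
      then have "t i \<le> card (\<sigma> ` (V - A))" unfolding t_def using fin by (intro card_mono) auto
      then show "t i \<le> h" using cY by simp
    qed
    have PI: "P \<subseteq> I" using t_less t_le by (fastforce simp: P_def I_def m_def)
    have "card P \<le> M_val n h D"
    proof -
      define J where "J = {j\<in>{1..n}. w j \<in> \<sigma> ` (V - A)}"
      have wJ: "w ` J = \<sigma> ` (V - A)" using assms(3) unfolding J_def YW by (auto simp: bij_betw_def)
      have J: "J \<subseteq> {1..n}" by (auto simp: J_def)
      have injw: "inj_on w J"
        by (rule inj_on_subset[OF bij_betw_imp_inj_on[OF assms(3)] J])
      have cJ: "card J = h" using card_image[OF injw] wJ cY by simp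
      have "card P = (\<Sum>x\<in>A. card (N x - \<sigma> ` A))"
        using sum.reindex_bij_betw[OF bijA, of "\<lambda>x. card (N x - \<sigma> ` A)"] by (simp add: P_def t_def)
      then have "card P + h \<le> (\<Sum>y\<in>\<sigma> ` (V - A). vertex_degree E y)"
        using sum_card_unused_neighbours_le[OF G AV \<sigma>[unfolded S_def]] cardVA by (simp add: N_def)
      also have "\<dots> = (\<Sum>j\<in>J. D j)"
        unfolding wJ[symmetric] sum.reindex[OF injw] using assms(5) by (intro sum.cong) (auto simp: J_def)
      also have "\<dots> \<le> (\<Sum>j=1..h. D (n + 1 - j))"
        using sum_le_sum_last[OF assms(9) J] unfolding cJ .
      finally show ?thesis unfolding M_val_def by linarith
    qed
    moreover have "card P \<le> size \<Gamma>" using PI finI by (simp add: \<Gamma> card_mono)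
    ultimately have cP: "card P \<le> q" by (simp add: assms(13))
    have "(\<Sum>x\<in>A. H_val (card (N x - \<sigma> ` A)) (card (N x))) = (\<Sum>i=1..m. H_val (t i) (d i))"
      using sum.reindex_bij_betw[OF bijA, of "\<lambda>x. H_val (card (N x - \<sigma> ` A)) (card (N x))"] cardN
      by (simp add: t_def)
    also have "\<dots> = (\<Sum>i=1..m. H_val 0 (d i)) + (\<Sum>i=1..m. \<Sum>s<t i. Delta s (d i))"
      by (simp add: H_val_eq_sum_Delta[of "t _"] sum.distrib)
    also have "(\<Sum>i=1..m. \<Sum>s<t i. Delta s (d i)) = (\<Sum>(i, s)\<in>P. Delta s (d i))"
      unfolding P_def by (rule sum.Sigma) auto
    also have "\<dots> \<le> (\<Sum>r=1..q. nth_largest \<Gamma> r)"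
    proof (rule sum_le_sum_nth_largest[OF finI PI _ \<Gamma> cP])
      show "q \<le> size \<Gamma>" by (simp add: assms(13))
      show "0 \<le> (case p of (i, t) \<Rightarrow> Delta t (d i))" if "p \<in> I" for p
        using that by (auto simp: I_def intro!: Delta_nonneg)
    qed
    finally show ?thesis by (simp add: C_def)
  qed

  have "real (card (perfect_matchings (V \<union> W) E)) \<le> real (card S)"
    using card_perfect_matchings_le[OF G] by (simp add: S_def)
  also have "\<dots> \<le> fact h * 2 powr C"
  proof (rule card_le_of_H_val_bound[OF finS finA _ _ _ _ _ pointwise])
    show "finite (N x)" for x using fin by (simp add: N_def)
    show "inj_on \<sigma> A" if "\<sigma> \<in> S" for \<sigma>
      using that AV inj_on_subset[of \<sigma> V A] by (simp add: S_def matching_maps_def bij_betw_def)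
    show "\<sigma> x \<in> N x" if "\<sigma> \<in> S" "x \<in> A" for \<sigma> x
      using that AV by (auto simp: S_def matching_maps_def N_def)
    show "real (card {\<sigma>\<in>S. \<forall>x\<in>A. \<sigma> x = \<tau> x}) \<le> fact h" if "\<tau> \<in> S" for \<tau>
      using of_nat_mono[OF card_matching_maps_agreeing_le[OF fin AV that[unfolded S_def]], where 'a = real]
      by (simp add: cardVA S_def)
  qed simp
  also have "2 powr C = (\<Prod>i=1..m. fact (d i) powr (1 / real (d i))) * (\<Prod>r=1..q. 2 powr nth_largest \<Gamma> r)"
  proof -
    have "2 powr H_val 0 k = fact k powr (1 / real k)" for k
    proof -
      have "2 powr H_val 0 k = (2 powr log 2 (fact k)) powr (1 / real k)"
        unfolding powr_powr by (simp add: H_val_def)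
      then show ?thesis by (simp only: powr_log_cancel[of 2 "fact k :: real"]) simp
    qed
    then show ?thesis unfolding C_def powr_add by (simp add: powr_sum)
  qed
  finally show ?thesis by (simp add: m_def mult.assoc)
qed

end
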